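(* Let $\pi_1,\pi_2$ be unitary representations of a discrete group $\Gamma$. Then for $i=1,2$ there is a $\Gamma$-map $\mathcal{B}_{\pi_i}\to\mathcal{B}_{\pi_1\otimes\pi_2}$.
   Context: For a unitary representation $\pi:\Gamma\to\mathcal{U}(\mathcal{H}_\pi)$, $\Gamma$ acts on $B(\mathcal{H}_\pi)$ by $g\cdot x=\pi(g)x\pi(g^{-1})$. A $\Gamma$-map between operator systems carrying $\Gamma$-actions is a unital completely positive $\Gamma$-equivariant linear map. Furstenberg--Hamana (FH) boundary: on the set $\mathcal{G}$ of all $\Gamma$-maps $\phi:B(\mathcal{H}_\pi)\to B(\mathcal{H}_\pi)$ put the preorder $\phi\le\psi$ iff $\|\phi(x)\|\le\|\psi(x)\|$ for all $x$. Then $\mathcal{G}$ has minimal elements, every minimal element is idempotent, and its image is unique up to bijective completely isometric $\Gamma$-maps. $\mathcal{B}_\pi$ is the image of a minimal $\phi\in\mathcal{G}$, with the Choi--Effros product $a\cdot b=\phi(ab)$ and the restricted $\Gamma$-action; it is a $\Gamma$-$C^*$-algebra. *)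

theory Defs
  imports "HOL-Analysis.Analysis" "HOL-Algebra.Group"
begin

section \<open>Complex Hilbert spaces\<close>

class complex_vector = ab_group_add +
  fixes scaleC :: "complex \<Rightarrow> 'a \<Rightarrow> 'a" (infixr "*\<^sub>C" 75)
  assumes scaleC_add_right: "c *\<^sub>C (x + y) = c *\<^sub>C x + c *\<^sub>C y"
    and scaleC_add_left: "(c + d) *\<^sub>C x = c *\<^sub>C x + d *\<^sub>C x"
    and scaleC_scaleC: "c *\<^sub>C d *\<^sub>C x = (c * d) *\<^sub>C x"
    and scaleC_one: "1 *\<^sub>C x = x"

interpretation complex_vector: vector_space "scaleC :: complex \<Rightarrow> 'a \<Rightarrow> 'a::complex_vector"
  by unfold_locales (simp_all add: scaleC_add_right scaleC_add_left scaleC_scaleC scaleC_one)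

text \<open>The inner product is linear in the first argument; completeness is part of \<^class>\<open>banach\<close>.\<close>

class chilbert_space = banach + complex_vector +
  fixes cinner :: "'a \<Rightarrow> 'a \<Rightarrow> complex"
  assumes scaleR_scaleC: "r *\<^sub>R x = complex_of_real r *\<^sub>C x"
    and cinner_commute: "cinner x y = cnj (cinner y x)"
    and cinner_add_left: "cinner (x + y) z = cinner x z + cinner y z"
    and cinner_scaleC_left: "cinner (c *\<^sub>C x) y = c * cinner x y"
    and cinner_self: "cinner x x = complex_of_real ((norm x)\<^sup>2)"

instantiation complex :: chilbert_space
begin

definition scaleC_complex :: "complex \<Rightarrow> complex \<Rightarrow> complex" where
  "scaleC_complex c x = c * x"

definition cinner_complex :: "complex \<Rightarrow> complex \<Rightarrow> complex" where
  "cinner_complex x y = x * cnj y"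

instance
proof
  fix r :: real and c d x y z :: complex
  show "c *\<^sub>C (x + y) = c *\<^sub>C x + c *\<^sub>C y" "(c + d) *\<^sub>C x = c *\<^sub>C x + d *\<^sub>C x"
    "c *\<^sub>C d *\<^sub>C x = (c * d) *\<^sub>C x" "1 *\<^sub>C x = x"
    by (simp_all add: scaleC_complex_def distrib_left distrib_right)
  show "r *\<^sub>R x = complex_of_real r *\<^sub>C x"
    by (simp add: scaleC_complex_def scaleR_conv_of_real)
  show "cinner x y = cnj (cinner y x)" "cinner (x + y) z = cinner x z + cinner y z"
    "cinner (c *\<^sub>C x) y = c * cinner x y"
    by (simp_all add: scaleC_complex_def cinner_complex_def distrib_right)
  show "cinner x x = complex_of_real ((norm x)\<^sup>2)"
    unfolding cinner_complex_def by (rule complex_norm_square [symmetric])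
qed

end

lemma norm_scaleC: "norm (c *\<^sub>C x) = norm c * norm (x :: 'a::chilbert_space)"
proof -
  have right: "cinner y (c *\<^sub>C x) = cnj c * cinner y x" for y :: 'a
    using cinner_commute [of y "c *\<^sub>C x"] cinner_commute [of y x]
    by (simp add: cinner_scaleC_left)
  have "complex_of_real ((norm (c *\<^sub>C x))\<^sup>2) = (c * cnj c) * complex_of_real ((norm x)\<^sup>2)"
    unfolding cinner_self [symmetric] by (simp only: right cinner_scaleC_left ac_simps)
  also have "\<dots> = complex_of_real ((norm c)\<^sup>2) * complex_of_real ((norm x)\<^sup>2)"
    by (simp only: complex_norm_square)
  also have "\<dots> = complex_of_real ((norm c * norm x)\<^sup>2)"
    by (simp only: of_real_mult power_mult_distrib)
  finally have "(norm (c *\<^sub>C x))\<^sup>2 = (norm c * norm x)\<^sup>2"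
    by (simp only: of_real_eq_iff)
  then show ?thesis
    by (rule power2_eq_imp_eq) simp_all
qed

lemma bounded_linear_scaleC: "bounded_linear (\<lambda>x :: 'a::chilbert_space. c *\<^sub>C x)"
proof (rule bounded_linear_intro)
  fix x y :: 'a and r :: real
  show "c *\<^sub>C (x + y) = c *\<^sub>C x + c *\<^sub>C y"
    by (rule scaleC_add_right)
  show "c *\<^sub>C r *\<^sub>R x = r *\<^sub>R c *\<^sub>C x"
    by (simp only: scaleR_scaleC scaleC_scaleC mult.commute)
  show "norm (c *\<^sub>C x) \<le> norm x * norm c"
    by (simp only: norm_scaleC mult.commute)
qed


section \<open>The algebra of bounded operators on a Hilbert space\<close>

text \<open>\<open>'a bop\<close> is $B(H)$ for the Hilbert space \<open>'a\<close>: the bounded real-linear maps of the library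
  which commute with complex scalars. The multiplication is composition.\<close>

typedef (overloaded) 'a bop =
  "{T :: 'a::chilbert_space \<Rightarrow>\<^sub>L 'a. \<forall>c x. blinfun_apply T (c *\<^sub>C x) = c *\<^sub>C blinfun_apply T x}"
  morphisms blinfun_of_bop Abs_bop
  by (rule exI [of _ 0]) simp

setup_lifting type_definition_bop

lift_definition bop_apply :: "'a::chilbert_space bop \<Rightarrow> 'a \<Rightarrow> 'a" is blinfun_apply .

lemma bop_eqI:
  assumes "\<And>x. bop_apply S x = bop_apply T x"
  shows "S = T"
  using assms by transfer (rule blinfun_eqI)

instantiation bop :: (chilbert_space) "{complex_vector, ring, monoid_mult}"
begin

lift_definition zero_bop :: "'a bop" is 0 by simp

lift_definition plus_bop :: "'a bop \<Rightarrow> 'a bop \<Rightarrow> 'a bop" is "(+)"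
  by (simp add: blinfun.add_left scaleC_add_right)

lift_definition uminus_bop :: "'a bop \<Rightarrow> 'a bop" is uminus
  by (simp add: blinfun.minus_left)

lift_definition minus_bop :: "'a bop \<Rightarrow> 'a bop \<Rightarrow> 'a bop" is "(-)"
  by (simp add: blinfun.diff_left complex_vector.scale_right_diff_distrib)

lift_definition one_bop :: "'a bop" is id_blinfun by simp

lift_definition times_bop :: "'a bop \<Rightarrow> 'a bop \<Rightarrow> 'a bop" is "(o\<^sub>L)" by simp

lift_definition scaleC_bop :: "complex \<Rightarrow> 'a bop \<Rightarrow> 'a bop" is
  "\<lambda>c T. Blinfun (\<lambda>x. c *\<^sub>C x) o\<^sub>L T"
  by (simp add: bounded_linear_Blinfun_apply bounded_linear_scaleC scaleC_scaleC mult.commute)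

lemma bop_apply_simps [simp]:
  "bop_apply 0 x = 0"
  "bop_apply (S + T) x = bop_apply S x + bop_apply T x"
  "bop_apply (- T) x = - bop_apply T x"
  "bop_apply (S - T) x = bop_apply S x - bop_apply T x"
  "bop_apply 1 x = x"
  "bop_apply (S * T) x = bop_apply S (bop_apply T x)"
  "bop_apply (c *\<^sub>C T) x = c *\<^sub>C bop_apply T x"
        apply (transfer, simp)
       apply (transfer, simp add: blinfun.add_left)
      apply (transfer, simp add: blinfun.minus_left)
     apply (transfer, simp add: blinfun.diff_left)
    apply (transfer, simp)
   apply (transfer, simp)
  apply (transfer, simp add: bounded_linear_Blinfun_apply bounded_linear_scaleC)
  done

lemma bop_apply_add_right: "bop_apply T (x + y) = bop_apply T x + bop_apply T y"
  by transfer (rule blinfun.add_right)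

lemma bop_apply_scaleC_right: "bop_apply T (c *\<^sub>C x) = c *\<^sub>C bop_apply T x"
  by transfer simp

instance
  by standard
    (rule bop_eqI, simp add: bop_apply_add_right bop_apply_scaleC_right
      scaleC_add_right scaleC_add_left scaleC_scaleC scaleC_one add.assoc)+

end

instantiation bop :: (chilbert_space) real_normed_vector
begin

lift_definition scaleR_bop :: "real \<Rightarrow> 'a bop \<Rightarrow> 'a bop" is scaleR
  by (simp add: blinfun.scaleR_left scaleR_scaleC scaleC_scaleC mult.commute)

lift_definition norm_bop :: "'a bop \<Rightarrow> real" is norm .

definition dist_bop :: "'a bop \<Rightarrow> 'a bop \<Rightarrow> real" where
  "dist_bop S T = norm (S - T)"

definition sgn_bop :: "'a bop \<Rightarrow> 'a bop" where
  "sgn_bop T = inverse (norm T) *\<^sub>R T"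

definition uniformity_bop :: "('a bop \<times> 'a bop) filter" where
  "uniformity_bop = (INF e\<in>{0<..}. principal {(S, T). dist S T < e})"

definition open_bop :: "'a bop set \<Rightarrow> bool" where
  "open_bop U = (\<forall>S\<in>U. \<forall>\<^sub>F (S', T) in uniformity. S' = S \<longrightarrow> T \<in> U)"

instance
proof
  fix a b :: real and S T :: "'a bop" and U :: "'a bop set"
  show "dist S T = norm (S - T)"
    by (fact dist_bop_def)
  show "sgn T = inverse (norm T) *\<^sub>R T"
    by (fact sgn_bop_def)
  show "(uniformity :: ('a bop \<times> 'a bop) filter) = (INF e\<in>{0<..}. principal {(S, T). dist S T < e})"
    by (fact uniformity_bop_def)
  show "open U = (\<forall>S\<in>U. \<forall>\<^sub>F (S', T) in uniformity. S' = S \<longrightarrow> T \<in> U)"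
    by (fact open_bop_def)
  show "a *\<^sub>R (S + T) = a *\<^sub>R S + a *\<^sub>R T"
    by transfer (rule scaleR_add_right)
  show "(a + b) *\<^sub>R T = a *\<^sub>R T + b *\<^sub>R T"
    by transfer (rule scaleR_add_left)
  show "a *\<^sub>R b *\<^sub>R T = (a * b) *\<^sub>R T"
    by transfer (rule scaleR_scaleR)
  show "1 *\<^sub>R T = T"
    by transfer (rule scaleR_one)
  show "norm T = 0 \<longleftrightarrow> T = 0"
    by transfer (rule norm_eq_zero)
  show "norm (S + T) \<le> norm S + norm T"
    by transfer (rule norm_triangle_ineq)
  show "norm (a *\<^sub>R T) = \<bar>a\<bar> * norm T"
    by transfer (rule norm_scaleR)
qed

end

text \<open>A matrix over $B(H)$ is positive if it is a positive operator on $H^n$.\<close>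

definition positive_matrix :: "nat \<Rightarrow> (nat \<Rightarrow> nat \<Rightarrow> 'a::chilbert_space bop) \<Rightarrow> bool" where
  "positive_matrix n A \<longleftrightarrow>
    (\<forall>\<xi>. (\<Sum>i<n. \<Sum>j<n. cinner (bop_apply (A i j) (\<xi> j)) (\<xi> i)) \<in> \<real>\<^sub>\<ge>\<^sub>0)"


section \<open>Unitary representations and equivariant maps\<close>

definition unitary :: "'a::chilbert_space bop \<Rightarrow> bool" where
  "unitary U \<longleftrightarrow> surj (bop_apply U) \<and>
    (\<forall>x y. cinner (bop_apply U x) (bop_apply U y) = cinner x y)"

definition unitary_group :: "'a::chilbert_space bop monoid" where
  "unitary_group = \<lparr>carrier = {U. unitary U}, mult = (*), one = 1\<rparr>"

definition unitary_rep :: "('g, 'm) monoid_scheme \<Rightarrow> ('g \<Rightarrow> 'a::chilbert_space bop) \<Rightarrow> bool" where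
  "unitary_rep G \<pi> \<longleftrightarrow> \<pi> \<in> hom G unitary_group"

definition conj_action ::
    "('g, 'm) monoid_scheme \<Rightarrow> ('g \<Rightarrow> 'a::chilbert_space bop) \<Rightarrow> 'g \<Rightarrow> 'a bop \<Rightarrow> 'a bop" where
  "conj_action G \<pi> g x = \<pi> g * x * \<pi> (inv\<^bsub>G\<^esub> g)"

text \<open>Unital completely positive equivariant linear maps from an operator system
  $S \subseteq B(H)$ to an operator system $T \subseteq B(K)$, each invariant under the conjugation
  action. The matrix order of $S$ and $T$ is the one inherited from $B(H)$ and $B(K)$, and only
  the values of the map on $S$ matter.\<close>

definition Gamma_map ::
    "('g, 'm) monoid_scheme \<Rightarrow> ('g \<Rightarrow> 'a::chilbert_space bop) \<Rightarrow> 'a bop set \<Rightarrow>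
     ('g \<Rightarrow> 'b::chilbert_space bop) \<Rightarrow> 'b bop set \<Rightarrow> ('a bop \<Rightarrow> 'b bop) \<Rightarrow> bool" where
  "Gamma_map G \<pi> S \<rho> T \<Psi> \<longleftrightarrow>
    \<Psi> \<in> S \<rightarrow> T \<and>
    (\<forall>x\<in>S. \<forall>y\<in>S. \<Psi> (x + y) = \<Psi> x + \<Psi> y) \<and>
    (\<forall>c. \<forall>x\<in>S. \<Psi> (c *\<^sub>C x) = c *\<^sub>C \<Psi> x) \<and>
    \<Psi> 1 = 1 \<and>
    (\<forall>n A. (\<forall>i<n. \<forall>j<n. A i j \<in> S) \<and> positive_matrix n A \<longrightarrow>
      positive_matrix n (\<lambda>i j. \<Psi> (A i j))) \<and>
    (\<forall>g\<in>carrier G. \<forall>x\<in>S. \<Psi> (conj_action G \<pi> g x) = conj_action G \<rho> g (\<Psi> x))"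


section \<open>The Furstenberg--Hamana boundary\<close>

definition Gamma_endos ::
    "('g, 'm) monoid_scheme \<Rightarrow> ('g \<Rightarrow> 'a::chilbert_space bop) \<Rightarrow> ('a bop \<Rightarrow> 'a bop) set" where
  "Gamma_endos G \<pi> = {\<phi>. Gamma_map G \<pi> UNIV \<pi> UNIV \<phi>}"

definition map_le :: "('a::chilbert_space bop \<Rightarrow> 'a bop) \<Rightarrow> ('a bop \<Rightarrow> 'a bop) \<Rightarrow> bool" where
  "map_le \<phi> \<psi> \<longleftrightarrow> (\<forall>x. norm (\<phi> x) \<le> norm (\<psi> x))"

definition minimal_Gamma_endo ::
    "('g, 'm) monoid_scheme \<Rightarrow> ('g \<Rightarrow> 'a::chilbert_space bop) \<Rightarrow> ('a bop \<Rightarrow> 'a bop) \<Rightarrow> bool" where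
  "minimal_Gamma_endo G \<pi> \<phi> \<longleftrightarrow>
    \<phi> \<in> Gamma_endos G \<pi> \<and> (\<forall>\<psi>\<in>Gamma_endos G \<pi>. map_le \<psi> \<phi> \<longrightarrow> map_le \<phi> \<psi>)"

text \<open>The boundary is determined only up to bijective completely isometric equivariant maps, so it
  is a predicate: \<open>B\<close> is the image of some minimal \<open>\<phi>\<close>. It is considered with the unit, the matrix
  order and the action inherited from $B(H)$; the Choi--Effros product $a \cdot b = \phi(ab)$
  induces the same matrix order (Choi--Effros), and does not enter the notion of an
  equivariant unital completely positive map.\<close>

definition FH_boundary ::
    "('g, 'm) monoid_scheme \<Rightarrow> ('g \<Rightarrow> 'a::chilbert_space bop) \<Rightarrow> 'a bop set \<Rightarrow> bool" where
  "FH_boundary G \<pi> B \<longleftrightarrow> (\<exists>\<phi>. minimal_Gamma_endo G \<pi> \<phi> \<and> B = range \<phi>)"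


section \<open>Tensor products\<close>

text \<open>\<open>'c\<close>, with elementary tensors \<open>t x y\<close>, is the Hilbert space tensor product of
  \<open>'a\<close> and \<open>'b\<close>; this determines the pair \<open>('c, t)\<close> up to a unique unitary.\<close>

definition hilbert_tensor ::
    "('a::chilbert_space \<Rightarrow> 'b::chilbert_space \<Rightarrow> 'c::chilbert_space) \<Rightarrow> bool" where
  "hilbert_tensor t \<longleftrightarrow>
    (\<forall>x x' y. t (x + x') y = t x y + t x' y) \<and>
    (\<forall>x y y'. t x (y + y') = t x y + t x y') \<and>
    (\<forall>c x y. t (c *\<^sub>C x) y = c *\<^sub>C t x y) \<and>
    (\<forall>c x y. t x (c *\<^sub>C y) = c *\<^sub>C t x y) \<and>
    (\<forall>x y x' y'. cinner (t x y) (t x' y') = cinner x x' * cinner y y') \<and>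
    closure (complex_vector.span {t x y |x y. True}) = UNIV"

text \<open>For bounded \<open>S\<close> and \<open>T\<close> there is exactly one bounded operator as described.\<close>

definition op_tensor ::
    "('a::chilbert_space \<Rightarrow> 'b::chilbert_space \<Rightarrow> 'c::chilbert_space) \<Rightarrow>
     'a bop \<Rightarrow> 'b bop \<Rightarrow> 'c bop" where
  "op_tensor t S T = (THE R. \<forall>x y. bop_apply R (t x y) = t (bop_apply S x) (bop_apply T y))"

definition rep_tensor ::
    "('a::chilbert_space \<Rightarrow> 'b::chilbert_space \<Rightarrow> 'c::chilbert_space) \<Rightarrow>
     ('g \<Rightarrow> 'a bop) \<Rightarrow> ('g \<Rightarrow> 'b bop) \<Rightarrow> 'g \<Rightarrow> 'c bop" where
  "rep_tensor t \<pi> \<rho> g = op_tensor t (\<pi> g) (\<rho> g)"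

end

theory Submission
  imports Defs
begin

text \<open>
  The amplification \<open>x \<mapsto> x \<otimes> 1\<close> is an equivariant unital completely positive map from $B(H_1)$
  to $B(H_1 \otimes H_2)$: it intertwines the conjugation actions because
  $(\pi_1(g) \otimes \pi_2(g)) (x \otimes 1) (\pi_1(g^{-1}) \otimes \pi_2(g^{-1}))
  = \pi_1(g) x \pi_1(g^{-1}) \otimes 1$. If \<open>\<phi>\<close> is any equivariant unital completely positive
  map with image \<open>B\<close>, then \<open>x \<mapsto> \<phi> (x \<otimes> 1)\<close>, restricted to \<open>B\<^sub>1\<close>, is the required map into
  \<open>B\<close>. The second factor follows by exchanging the arguments of the tensor map.

  The work lies in the operator \<open>x \<otimes> 1\<close> and its complete positivity. Both rest on one
  observation, obtained from Gram--Schmidt in the second factor: finitely many finite sums of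
  elementary tensors can be written as $\sum_{e \in E} z_e \otimes e$ with one finite orthonormal
  set $E$. Since $\langle \sum_e z_e \otimes e, \sum_e w_e \otimes e \rangle =
  \sum_e \langle z_e, w_e \rangle$, the norm bound $\|(x \otimes 1) v\| \le \|x\| \|v\|$ and
  positivity of $(A_{ij} \otimes 1)$ can be checked separately for each $e$
  (\<open>norm_tsum_le\<close>, \<open>positive_matrix_op_tensor_one\<close>), and both pass to the closure.
\<close>

section \<open>Inner products and bounded operators\<close>

lemma cinner_add_right: "cinner x (y + z) = cinner x y + cinner x (z :: 'a::chilbert_space)"
  by (metis cinner_add_left cinner_commute complex_cnj_add)

lemma cinner_scaleC_right: "cinner x (c *\<^sub>C y) = cnj c * cinner x (y :: 'a::chilbert_space)"
  by (metis cinner_commute cinner_scaleC_left complex_cnj_mult)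

lemma cinner_zero_left [simp]: "cinner 0 (y :: 'a::chilbert_space) = 0"
  using cinner_add_left [of 0 0 y] by simp

lemma cinner_zero_right [simp]: "cinner (y :: 'a::chilbert_space) 0 = 0"
  using cinner_add_right [of y 0 0] by simp

lemma cinner_sum_left: "cinner (sum f A) (y :: 'a::chilbert_space) = (\<Sum>i\<in>A. cinner (f i) y)"
  by (induction A rule: infinite_finite_induct) (simp_all add: cinner_add_left)

lemma cinner_sum_right: "cinner (y :: 'a::chilbert_space) (sum f A) = (\<Sum>i\<in>A. cinner y (f i))"
  by (induction A rule: infinite_finite_induct) (simp_all add: cinner_add_right)

lemma cinner_diff_left: "cinner (x - y) z = cinner x z - cinner y (z :: 'a::chilbert_space)"
  using cinner_add_left [of "x - y" y z] by simp

lemma Re_cinner: "Re (cinner x (y :: 'a::chilbert_space)) =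
    ((norm (x + y))\<^sup>2 - (norm x)\<^sup>2 - (norm y)\<^sup>2) / 2"
proof -
  have "complex_of_real ((norm (x + y))\<^sup>2) =
      complex_of_real ((norm x)\<^sup>2) + cinner x y + cnj (cinner x y) + complex_of_real ((norm y)\<^sup>2)"
    unfolding cinner_self [symmetric] cinner_commute [of y x, symmetric]
    by (simp add: cinner_add_left cinner_add_right)
  from arg_cong [OF this, of Re] show ?thesis
    by simp
qed

lemma cinner_polarization: "cinner x (y :: 'a::chilbert_space) =
    Complex (((norm (x + y))\<^sup>2 - (norm x)\<^sup>2 - (norm y)\<^sup>2) / 2)
      (((norm (x + \<i> *\<^sub>C y))\<^sup>2 - (norm x)\<^sup>2 - (norm (\<i> *\<^sub>C y))\<^sup>2) / 2)"
  unfolding Re_cinner [symmetric] by (simp add: cinner_scaleC_right complex_eq_iff)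

lemma tendsto_scaleC:
  "(f \<longlongrightarrow> x) F \<Longrightarrow> ((\<lambda>n. c *\<^sub>C f n) \<longlongrightarrow> c *\<^sub>C (x :: 'a::chilbert_space)) F"
  by (rule bounded_linear.tendsto [OF bounded_linear_scaleC])

lemma tendsto_cinner:
  assumes "(f \<longlongrightarrow> x) F" and "(g \<longlongrightarrow> (y :: 'a::chilbert_space)) F"
  shows "((\<lambda>n. cinner (f n) (g n)) \<longlongrightarrow> cinner x y) F"
  unfolding cinner_polarization by (intro tendsto_intros tendsto_scaleC assms) simp_all

lemma bounded_linear_bop_apply: "bounded_linear (bop_apply T)"
  by transfer (rule blinfun.bounded_linear_right)

lemma bop_apply_zero_right [simp]: "bop_apply T 0 = 0"
  by (rule linear_0 [OF bounded_linear.linear [OF bounded_linear_bop_apply]])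

lemma norm_bop_apply_le: "norm (bop_apply T x) \<le> norm T * norm x"
  by transfer (rule norm_blinfun)

lemma bop_of_bounded_function:
  fixes f :: "'a::chilbert_space \<Rightarrow> 'a"
  assumes add: "\<And>x y. f (x + y) = f x + f y"
    and scale: "\<And>c x. f (c *\<^sub>C x) = c *\<^sub>C f x"
    and bound: "\<And>x. norm (f x) \<le> K * norm x"
  obtains T where "bop_apply T = f"
proof -
  have bl: "bounded_linear f"
    by (rule bounded_linear_intro [where K = K])
      (simp_all add: add scaleR_scaleC scale bound mult.commute)
  then have "bop_apply (Abs_bop (Blinfun f)) = f"
    by (simp add: bop_apply.rep_eq Abs_bop_inverse scale bounded_linear_Blinfun_apply)
  then show ?thesis
    by (rule that)
qed

text \<open>A bounded densely defined operator, given by its graph \<open>R\<close>, extends to the whole space.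
  The extension is the operator whose graph is the closure of \<open>R\<close>; the bound makes
  the closure single-valued, completeness makes it total.\<close>

lemma bop_extension:
  fixes R :: "('a::chilbert_space \<times> 'a) set"
  assumes add: "\<And>v w v' w'. (v, w) \<in> R \<Longrightarrow> (v', w') \<in> R \<Longrightarrow> (v + v', w + w') \<in> R"
    and scale: "\<And>c v w. (v, w) \<in> R \<Longrightarrow> (c *\<^sub>C v, c *\<^sub>C w) \<in> R"
    and bound: "\<And>v w. (v, w) \<in> R \<Longrightarrow> norm w \<le> K * norm v"
    and dense: "closure (fst ` R) = UNIV"
  shows "\<exists>T. \<forall>v w. (v, w) \<in> R \<longrightarrow> bop_apply T v = w"
proof -
  define Q where "Q = closure R"
  have diff: "(v - v', w - w') \<in> R" if "(v, w) \<in> R" "(v', w') \<in> R" for v w v' w'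
    using add [OF that(1) scale [OF that(2), of "- 1"]]
    by (simp add: complex_vector.scale_minus_left scaleC_one)
  have Q_seq: "\<exists>f g. (\<forall>n. (f n, g n) \<in> R) \<and> f \<longlonglongrightarrow> v \<and> g \<longlonglongrightarrow> w" if vw: "(v, w) \<in> Q" for v w
  proof -
    obtain h where h: "\<And>n. h n \<in> R" "h \<longlonglongrightarrow> (v, w)"
      using vw unfolding Q_def closure_sequential by blast
    show ?thesis
      using h(1) tendsto_fst [OF h(2)] tendsto_snd [OF h(2)]
      by (intro exI [of _ "\<lambda>n. fst (h n)"] exI [of _ "\<lambda>n. snd (h n)"]) simp
  qed
  have Q_lim: "(v, w) \<in> Q" if "\<And>n. (f n, g n) \<in> R" "f \<longlonglongrightarrow> v" "g \<longlonglongrightarrow> w" for f g v w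
    unfolding Q_def closure_sequential using that tendsto_Pair
    by (intro exI [of _ "\<lambda>n. (f n, g n)"]) blast
  have Q_add: "(v + v', w + w') \<in> Q" if vw: "(v, w) \<in> Q" "(v', w') \<in> Q" for v w v' w'
  proof -
    obtain f g f' g' where "\<And>n. (f n, g n) \<in> R" "f \<longlonglongrightarrow> v" "g \<longlonglongrightarrow> w"
      "\<And>n. (f' n, g' n) \<in> R" "f' \<longlonglongrightarrow> v'" "g' \<longlonglongrightarrow> w'"
      using Q_seq [OF vw(1)] Q_seq [OF vw(2)] by auto
    then show ?thesis
      by (intro Q_lim [of "\<lambda>n. f n + f' n" "\<lambda>n. g n + g' n"] add tendsto_add)
  qed
  have Q_scale: "(c *\<^sub>C v, c *\<^sub>C w) \<in> Q" if vw: "(v, w) \<in> Q" for c v w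
  proof -
    obtain f g where "\<And>n. (f n, g n) \<in> R" "f \<longlonglongrightarrow> v" "g \<longlonglongrightarrow> w"
      using Q_seq [OF vw] by auto
    then show ?thesis
      by (intro Q_lim [of "\<lambda>n. c *\<^sub>C f n" "\<lambda>n. c *\<^sub>C g n"] scale tendsto_scaleC)
  qed
  have Q_bound: "norm w \<le> K * norm v" if vw: "(v, w) \<in> Q" for v w
  proof -
    obtain f g where fg: "\<And>n. (f n, g n) \<in> R" "f \<longlonglongrightarrow> v" "g \<longlonglongrightarrow> w"
      using Q_seq [OF vw] by auto
    show ?thesis
      using bound [OF fg(1)]
      by (intro LIMSEQ_le [OF tendsto_norm [OF fg(3)] tendsto_mult_left [OF tendsto_norm [OF fg(2)]]])
        blast
  qed
  have Q_unique: "w = w'" if "(v, w) \<in> Q" "(v, w') \<in> Q" for v w w'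
  proof -
    have "(v + (- 1) *\<^sub>C v, w + (- 1) *\<^sub>C w') \<in> Q"
      by (intro Q_add Q_scale that)
    from Q_bound [OF this] show ?thesis
      by (simp add: complex_vector.scale_minus_left scaleC_one)
  qed
  have Q_total: "\<exists>w. (v, w) \<in> Q" for v
  proof -
    have "v \<in> closure (fst ` R)"
      by (simp add: dense)
    then obtain f where f: "\<And>n. f n \<in> fst ` R" "f \<longlonglongrightarrow> v"
      unfolding closure_sequential by blast
    have "\<forall>n. \<exists>w. (f n, w) \<in> R"
      using f(1) by force
    then obtain g where g: "\<And>n. (f n, g n) \<in> R"
      by metis
    have "Cauchy g"
    proof (rule metric_CauchyI)
      fix e :: real
      assume "0 < e"
      then have "0 < e / (\<bar>K\<bar> + 1)"
        by simp
      then obtain N where N: "\<And>m n. N \<le> m \<Longrightarrow> N \<le> n \<Longrightarrow> dist (f m) (f n) < e / (\<bar>K\<bar> + 1)"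
        using LIMSEQ_imp_Cauchy [OF f(2)] unfolding Cauchy_def by blast
      have "dist (g m) (g n) < e" if "N \<le> m" "N \<le> n" for m n
      proof -
        have "dist (g m) (g n) \<le> K * dist (f m) (f n)"
          using bound [OF diff [OF g g]] by (simp add: dist_norm)
        also have "\<dots> \<le> (\<bar>K\<bar> + 1) * dist (f m) (f n)"
          by (rule mult_right_mono) simp_all
        also have "\<dots> < e"
          using N [OF that] by (simp add: field_simps)
        finally show ?thesis .
      qed
      then show "\<exists>M. \<forall>m\<ge>M. \<forall>n\<ge>M. dist (g m) (g n) < e"
        by blast
    qed
    then obtain w where "g \<longlonglongrightarrow> w"
      using Cauchy_convergent convergentD by blast
    then show ?thesis
      using Q_lim [OF g f(2)] by blast
  qed
  obtain F where F: "\<And>v. (v, F v) \<in> Q"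
    using Q_total by metis
  obtain T where T: "bop_apply T = F"
  proof (rule bop_of_bounded_function)
    show "F (x + y) = F x + F y" for x y
      by (rule Q_unique [OF F Q_add [OF F F]])
    show "F (c *\<^sub>C x) = c *\<^sub>C F x" for c x
      by (rule Q_unique [OF F Q_scale [OF F]])
    show "norm (F x) \<le> K * norm x" for x
      by (rule Q_bound [OF F])
  qed
  have "bop_apply T v = w" if "(v, w) \<in> R" for v w
    using Q_unique [OF F, of v w] that closure_subset [of R] by (auto simp: T Q_def)
  then show ?thesis
    by blast
qed


section \<open>Finite orthonormal sets\<close>

text \<open>The set is a family of vectors indexed by itself, so being orthonormal includes that its
  members are unit vectors.\<close>

definition orthonormal :: "'a::chilbert_space set \<Rightarrow> bool" where
  "orthonormal E \<longleftrightarrow> (\<forall>e\<in>E. \<forall>f\<in>E. cinner e f = (if e = f then 1 else 0))"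

text \<open>The expansion formula says that every \<open>y \<in> Y\<close> lies in the span of \<open>E\<close>, with the
  coefficients that \<open>E\<close> then forces.\<close>

lemma gram_schmidt:
  fixes Y :: "'a::chilbert_space set"
  assumes "finite Y"
  shows "\<exists>E. finite E \<and> orthonormal E \<and> (\<forall>y\<in>Y. (\<Sum>e\<in>E. cinner y e *\<^sub>C e) = y)"
  using assms
proof (induction Y)
  case empty
  show ?case
    by (rule exI [of _ "{}"]) (simp add: orthonormal_def)
next
  case (insert y Y)
  then obtain E where E: "finite E" "orthonormal E"
    and exp: "\<And>x. x \<in> Y \<Longrightarrow> (\<Sum>e\<in>E. cinner x e *\<^sub>C e) = x"
    by blast
  define p where "p = (\<Sum>e\<in>E. cinner y e *\<^sub>C e)"
  define q where "q = y - p"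
  have pe: "cinner p e = cinner y e" if "e \<in> E" for e
  proof -
    have "cinner p e = (\<Sum>f\<in>E. if f = e then cinner y e else 0)"
      unfolding p_def cinner_sum_left cinner_scaleC_left
      using E(2) that by (intro sum.cong) (auto simp: orthonormal_def)
    also have "\<dots> = cinner y e"
      using E(1) that by simp
    finally show ?thesis .
  qed
  have qe: "cinner q e = 0" if "e \<in> E" for e
    using pe [OF that] by (simp add: q_def cinner_diff_left)
  show ?case
  proof (cases "q = 0")
    case True
    then show ?thesis
      using E exp by (intro exI [of _ E]) (auto simp: q_def p_def)
  next
    case False
    define f where "f = complex_of_real (inverse (norm q)) *\<^sub>C q"
    have ff: "cinner f f = 1"
      using False by (simp add: f_def cinner_self norm_scaleC norm_inverse)
    have fe: "cinner f e = 0" "cinner e f = 0" if "e \<in> E" for e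
      using qe [OF that] cinner_commute [of e f]
      by (simp_all add: f_def cinner_scaleC_left)
    have notin: "f \<notin> E"
      using fe ff by force
    have q: "complex_of_real (norm q) *\<^sub>C f = q"
      using False by (simp add: f_def scaleC_scaleC scaleC_one flip: of_real_mult)
    have E_f: "cinner (\<Sum>e\<in>E. c e *\<^sub>C e) f = 0" for c
      by (simp add: cinner_sum_left cinner_scaleC_left fe)
    have "cinner y f = cinner p f + cinner q f"
      by (simp add: q_def cinner_diff_left)
    also have "\<dots> = complex_of_real (norm q)"
      by (subst q [symmetric]) (simp add: cinner_scaleC_left ff p_def E_f)
    finally have yf: "cinner y f *\<^sub>C f = q"
      using q by simp
    have "(\<Sum>e\<in>insert f E. cinner x e *\<^sub>C e) = x" if "x \<in> insert y Y" for x
    proof (cases "x = y")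
      case True
      then show ?thesis
        using E(1) notin yf by (simp add: q_def p_def)
    next
      case False
      then have x: "(\<Sum>e\<in>E. cinner x e *\<^sub>C e) = x"
        using exp that by blast
      then have "cinner x f = 0"
        using E_f by metis
      then show ?thesis
        using E(1) notin x by simp
    qed
    moreover have "orthonormal (insert f E)"
      using E(2) ff fe by (auto simp: orthonormal_def)
    ultimately show ?thesis
      using E(1) by (intro exI [of _ "insert f E"]) simp
  qed
qed


section \<open>Tensor products of operators\<close>

text \<open>A fixed Hilbert space tensor product. Its hypothesis is symmetric in the two factors, so the
  locale also applies to the flipped map \<open>\<lambda>y x. t x y\<close>.\<close>

locale tensor_product =
  fixes t :: "'a::chilbert_space \<Rightarrow> 'b::chilbert_space \<Rightarrow> 'c::chilbert_space"
  assumes tensor: "hilbert_tensor t"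
begin

lemma t_add_left: "t (x + x') y = t x y + t x' y"
  and t_add_right: "t x (y + y') = t x y + t x y'"
  and t_scaleC_left: "t (c *\<^sub>C x) y = c *\<^sub>C t x y"
  and t_scaleC_right: "t x (c *\<^sub>C y) = c *\<^sub>C t x y"
  and cinner_t: "cinner (t x y) (t x' y') = cinner x x' * cinner y y'"
  and closure_span_t: "closure (complex_vector.span {t x y |x y. True}) = UNIV"
  using tensor unfolding hilbert_tensor_def by blast+

lemma t_zero_left [simp]: "t 0 y = 0"
  using t_add_left [of 0 0 y] by simp

lemma t_zero_right [simp]: "t x 0 = 0"
  using t_add_right [of x 0 0] by simp

lemma t_sum_right: "t x (sum f A) = (\<Sum>i\<in>A. t x (f i))"
  by (induction A rule: infinite_finite_induct) (simp_all add: t_add_right)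

text \<open>The value of \<open>S \<otimes> 1\<close> on the sum of the elementary tensors listed in \<open>ps\<close>. This depends on
  the list and not only on the sum until \<open>S \<otimes> 1\<close> is known to exist.\<close>

definition tsum :: "'a bop \<Rightarrow> ('a \<times> 'b) list \<Rightarrow> 'c" where
  "tsum S ps = (\<Sum>(x, y)\<leftarrow>ps. t (bop_apply S x) y)"

lemma tsum_append: "tsum S (ps @ qs) = tsum S ps + tsum S qs"
  by (simp add: tsum_def)

lemma tsum_scaleC: "tsum S (map (\<lambda>(x, y). (c *\<^sub>C x, y)) ps) = c *\<^sub>C tsum S ps"
  by (induction ps)
    (auto simp: tsum_def bop_apply_scaleC_right t_scaleC_left scaleC_add_right)

lemma closure_range_tsum: "closure (range (tsum 1)) = UNIV"
proof -
  have "complex_vector.subspace (range (tsum 1))"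
  proof (rule complex_vector.subspaceI)
    show "0 \<in> range (tsum 1)"
      by (rule image_eqI [of _ _ "[]"]) (simp_all add: tsum_def)
    show "v + w \<in> range (tsum 1)" if "v \<in> range (tsum 1)" "w \<in> range (tsum 1)" for v w
      using that tsum_append [of 1, symmetric] by auto
    show "c *\<^sub>C v \<in> range (tsum 1)" if "v \<in> range (tsum 1)" for c v
      using that tsum_scaleC [of 1, symmetric] by auto
  qed
  moreover have "{t x y |x y. True} \<subseteq> range (tsum 1)"
  proof clarify
    fix x y
    show "t x y \<in> range (tsum 1)"
      by (rule image_eqI [of _ _ "[(x, y)]"]) (simp_all add: tsum_def)
  qed
  ultimately have "complex_vector.span {t x y |x y. True} \<subseteq> range (tsum 1)"
    by (intro complex_vector.span_minimal)
  then show ?thesis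
    using closure_mono closure_span_t by blast
qed

text \<open>The first-factor coefficient of \<open>e\<close> when every second factor in \<open>ps\<close> is expanded in an
  orthonormal set containing \<open>e\<close>.\<close>

definition coefficient :: "('a \<times> 'b) list \<Rightarrow> 'b \<Rightarrow> 'a" where
  "coefficient ps e = (\<Sum>(x, y)\<leftarrow>ps. cinner y e *\<^sub>C x)"

text \<open>The coefficients do not depend on \<open>S\<close>; this is what turns estimates for \<open>S\<close> into estimates
  for \<open>S \<otimes> 1\<close>.\<close>

lemma tsum_eq_orthonormal_sum:
  assumes "finite E" and "\<forall>y\<in>snd ` set ps. (\<Sum>e\<in>E. cinner y e *\<^sub>C e) = y"
  shows "tsum S ps = (\<Sum>e\<in>E. t (bop_apply S (coefficient ps e)) e)"
  using assms(2)
proof (induction ps)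
  case Nil
  show ?case
    by (simp add: tsum_def coefficient_def)
next
  case (Cons p ps)
  obtain x y where p: "p = (x, y)"
    by fastforce
  have "(\<Sum>e\<in>E. cinner y e *\<^sub>C e) = y"
    using Cons.prems p by simp
  then have "t (bop_apply S x) y = t (bop_apply S x) (\<Sum>e\<in>E. cinner y e *\<^sub>C e)"
    by simp
  also have "\<dots> = (\<Sum>e\<in>E. t (bop_apply S (cinner y e *\<^sub>C x)) e)"
    by (simp add: t_sum_right t_scaleC_right t_scaleC_left bop_apply_scaleC_right)
  finally have "t (bop_apply S x) y = \<dots>" .
  moreover have "tsum S ps = (\<Sum>e\<in>E. t (bop_apply S (coefficient ps e)) e)"
    using Cons by simp
  ultimately show ?case
    by (simp add: p tsum_def coefficient_def bop_apply_add_right t_add_left sum.distrib)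
qed

lemma cinner_orthonormal_sum:
  assumes "finite E" and "orthonormal E"
  shows "cinner (\<Sum>e\<in>E. t (z e) e) (\<Sum>e\<in>E. t (w e) e) = (\<Sum>e\<in>E. cinner (z e) (w e))"
proof -
  have "(\<Sum>f\<in>E. cinner (z e) (w f) * cinner e f) = cinner (z e) (w e)" if "e \<in> E" for e
  proof -
    have "(\<Sum>f\<in>E. cinner (z e) (w f) * cinner e f) =
        (\<Sum>f\<in>E. if f = e then cinner (z e) (w e) else 0)"
      using assms(2) that by (intro sum.cong) (auto simp: orthonormal_def)
    then show ?thesis
      using assms(1) that by simp
  qed
  then show ?thesis
    unfolding cinner_sum_left by (intro sum.cong refl) (simp add: cinner_sum_right cinner_t)
qed

lemma norm_tsum_le: "norm (tsum S ps) \<le> norm S * norm (tsum 1 ps)"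
proof -
  obtain E where E: "finite E" "orthonormal E"
    "\<forall>y\<in>snd ` set ps. (\<Sum>e\<in>E. cinner y e *\<^sub>C e) = y"
    using gram_schmidt [of "snd ` set ps"] by auto
  have norm_sq: "(norm (tsum S ps))\<^sup>2 = (\<Sum>e\<in>E. (norm (bop_apply S (coefficient ps e)))\<^sup>2)" for S
  proof -
    have "complex_of_real ((norm (tsum S ps))\<^sup>2) =
        complex_of_real (\<Sum>e\<in>E. (norm (bop_apply S (coefficient ps e)))\<^sup>2)"
      unfolding of_real_sum cinner_self [symmetric]
      by (simp only: tsum_eq_orthonormal_sum [OF E(1,3)] cinner_orthonormal_sum [OF E(1,2)])
    then show ?thesis
      by (simp only: of_real_eq_iff)
  qed
  have "(norm (tsum S ps))\<^sup>2 \<le> (\<Sum>e\<in>E. (norm S * norm (coefficient ps e))\<^sup>2)"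
    unfolding norm_sq by (intro sum_mono power_mono norm_bop_apply_le norm_ge_zero)
  also have "\<dots> = (norm S * norm (tsum 1 ps))\<^sup>2"
    by (simp add: power_mult_distrib norm_sq sum_distrib_left)
  finally show ?thesis
    by (rule power2_le_imp_le) (simp_all add: norm_bop.rep_eq)
qed

text \<open>The graph of \<open>S \<otimes> 1\<close> on finite sums of elementary tensors is the set of pairs
  \<open>(tsum 1 ps, tsum S ps)\<close>; the norm bound also shows that it is single-valued.\<close>

lemma amplification_exists:
  "\<exists>T. \<forall>x y. bop_apply T (t x y) = t (bop_apply S x) y"
proof -
  define R where "R = (\<lambda>ps. (tsum 1 ps, tsum S ps)) ` UNIV"
  have "\<exists>T. \<forall>v w. (v, w) \<in> R \<longrightarrow> bop_apply T v = w"
  proof (rule bop_extension)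
    show "(v + v', w + w') \<in> R" if "(v, w) \<in> R" "(v', w') \<in> R" for v w v' w'
      using that by (auto simp: R_def simp flip: tsum_append)
    show "(c *\<^sub>C v, c *\<^sub>C w) \<in> R" if "(v, w) \<in> R" for c v w
      using that by (auto simp: R_def simp flip: tsum_scaleC)
    show "norm w \<le> norm S * norm v" if "(v, w) \<in> R" for v w
      using that by (auto simp: R_def norm_tsum_le)
    have "fst ` R = range (tsum 1)"
      by (simp add: R_def image_image)
    then show "closure (fst ` R) = UNIV"
      by (simp add: closure_range_tsum)
  qed
  moreover have "(t x y, t (bop_apply S x) y) \<in> R" for x y
    unfolding R_def by (rule image_eqI [of _ _ "[(x, y)]"]) (simp_all add: tsum_def)
  ultimately show ?thesis
    by blast
qed

lemma hilbert_tensor_flip: "hilbert_tensor (\<lambda>y x. t x y)"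
proof -
  have "{t x y |y x. True} = {t x y |x y. True}"
    by blast
  then show ?thesis
    using closure_span_t
    by (simp add: hilbert_tensor_def t_add_left t_add_right t_scaleC_left t_scaleC_right cinner_t
        mult.commute)
qed

lemma bop_eq_on_tensors:
  assumes "\<And>x y. bop_apply S (t x y) = bop_apply T (t x y)"
  shows "S = T"
proof (rule bop_eqI)
  fix v
  have "bop_apply S (tsum 1 ps) = bop_apply T (tsum 1 ps)" for ps
    by (induction ps) (auto simp: tsum_def bop_apply_add_right assms)
  then have "range (tsum 1) \<subseteq> {v. bop_apply S v = bop_apply T v}"
    by auto
  moreover have "closed {v. bop_apply S v = bop_apply T v}"
    by (intro closed_Collect_eq linear_continuous_on bounded_linear_bop_apply)
  ultimately show "bop_apply S v = bop_apply T v"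
    using closure_minimal closure_range_tsum by blast
qed

lemma op_tensor_apply [simp]:
  "bop_apply (op_tensor t S T) (t x y) = t (bop_apply S x) (bop_apply T y)"
proof -
  interpret flip: tensor_product "\<lambda>y x. t x y"
    by unfold_locales (rule hilbert_tensor_flip)
  \<comment> \<open>\<open>S \<otimes> T\<close> is the product of \<open>S \<otimes> 1\<close> and \<open>1 \<otimes> T\<close>.\<close>
  obtain P where P: "\<And>x y. bop_apply P (t x y) = t (bop_apply S x) y"
    using amplification_exists [of S] by blast
  obtain Q where Q: "\<And>x y. bop_apply Q (t x y) = t x (bop_apply T y)"
    using flip.amplification_exists [of T] by blast
  have "\<exists>!R. \<forall>x y. bop_apply R (t x y) = t (bop_apply S x) (bop_apply T y)"
    using bop_eq_on_tensors by (intro ex1I [of _ "P * Q"]) (auto simp: P Q)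
  from theI' [OF this] show ?thesis
    by (simp add: op_tensor_def)
qed

lemma op_tensor_flip: "op_tensor (\<lambda>y x. t x y) T S = op_tensor t S T"
  unfolding op_tensor_def by (rule arg_cong [of _ _ The]) blast

lemma op_tensor_one_tsum: "bop_apply (op_tensor t S 1) (tsum 1 ps) = tsum S ps"
  by (induction ps) (auto simp: tsum_def bop_apply_add_right)

text \<open>For sums of elementary tensors, orthonormality in the second factor splits the quadratic
  form of $(A_{ij} \otimes 1)$ into a sum of values of the quadratic form of $(A_{ij})$.
  Such vectors are dense and the form is continuous.\<close>

lemma positive_matrix_op_tensor_one:
  assumes pos: "positive_matrix n A"
  shows "positive_matrix n (\<lambda>i j. op_tensor t (A i j) 1)"
proof -
  define form where "form \<xi> =
    (\<Sum>i<n. \<Sum>j<n. cinner (bop_apply (op_tensor t (A i j) 1) (\<xi> j)) (\<xi> i))" for \<xi>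
  have dense: "form (\<lambda>i. tsum 1 (ps i)) \<in> \<real>\<^sub>\<ge>\<^sub>0" for ps
  proof -
    obtain E where E: "finite E" "orthonormal E"
      "\<forall>y\<in>(\<Union>i<n. snd ` set (ps i)). (\<Sum>e\<in>E. cinner y e *\<^sub>C e) = y"
      using gram_schmidt [of "\<Union>i<n. snd ` set (ps i)"] by auto
    let ?z = "\<lambda>i. coefficient (ps i)"
    have expand: "tsum S (ps i) = (\<Sum>e\<in>E. t (bop_apply S (?z i e)) e)" if "i < n" for S i
      using E(1,3) that by (intro tsum_eq_orthonormal_sum) blast+
    have "form (\<lambda>i. tsum 1 (ps i)) =
        (\<Sum>i<n. \<Sum>j<n. \<Sum>e\<in>E. cinner (bop_apply (A i j) (?z j e)) (?z i e))"
      unfolding form_def op_tensor_one_tsum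
      by (intro sum.cong refl) (simp add: expand cinner_orthonormal_sum [OF E(1,2)])
    also have "\<dots> = (\<Sum>i<n. \<Sum>e\<in>E. \<Sum>j<n. cinner (bop_apply (A i j) (?z j e)) (?z i e))"
      by (intro sum.cong refl sum.swap)
    also have "\<dots> = (\<Sum>e\<in>E. \<Sum>i<n. \<Sum>j<n. cinner (bop_apply (A i j) (?z j e)) (?z i e))"
      by (rule sum.swap)
    also have "\<dots> \<in> \<real>\<^sub>\<ge>\<^sub>0"
    proof -
      have "(\<Sum>i<n. \<Sum>j<n. cinner (bop_apply (A i j) (?z j e)) (?z i e)) \<in> \<real>\<^sub>\<ge>\<^sub>0" for e
        using pos [unfolded positive_matrix_def, rule_format, of "\<lambda>i. ?z i e"] by simp
      then show ?thesis
        by (induction E rule: infinite_finite_induct) (simp_all add: nonneg_Reals_add_I)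
    qed
    finally show ?thesis .
  qed
  have "form \<xi> \<in> \<real>\<^sub>\<ge>\<^sub>0" for \<xi>
  proof -
    have "\<exists>f. (\<forall>m. f m \<in> range (tsum 1)) \<and> f \<longlonglongrightarrow> \<xi> i" for i
      using closure_range_tsum unfolding closure_sequential [symmetric] by simp
    then obtain f where f: "\<And>i m. f i m \<in> range (tsum 1)" "\<And>i. f i \<longlonglongrightarrow> \<xi> i"
      by metis
    then have "\<forall>i m. \<exists>ps. f i m = tsum 1 ps"
      by blast
    then obtain ps where ps: "\<And>i m. f i m = tsum 1 (ps i m)"
      by metis
    have lim: "(\<lambda>m. form (\<lambda>i. f i m)) \<longlonglongrightarrow> form \<xi>"
      unfolding form_def
      by (intro tendsto_sum tendsto_cinner f bounded_linear.tendsto [OF bounded_linear_bop_apply])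
    have "form (\<lambda>i. f i m) \<in> \<real>\<^sub>\<ge>\<^sub>0" for m
      unfolding ps by (rule dense)
    then show ?thesis
      by (rule closed_sequentially [OF closed_nonneg_Reals_complex _ lim])
  qed
  then show ?thesis
    unfolding positive_matrix_def form_def by blast
qed

end


section \<open>Equivariance of the amplification\<close>

lemma unitary_rep_mult_inv:
  fixes \<pi> :: "'g \<Rightarrow> 'a::chilbert_space bop"
  assumes "group G" and "unitary_rep G \<pi>" and g: "g \<in> carrier G"
  shows "\<pi> g * \<pi> (inv\<^bsub>G\<^esub> g) = 1"
proof -
  interpret group G by fact
  have hom: "\<pi> \<in> hom G unitary_group"
    using assms(2) by (simp add: unitary_rep_def)
  have mult: "\<pi> (x \<otimes>\<^bsub>G\<^esub> y) = \<pi> x * \<pi> y" if "x \<in> carrier G" "y \<in> carrier G" for x y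
    using hom_mult [OF hom that] by (simp add: unitary_group_def)
  have surj: "surj (bop_apply (\<pi> \<one>\<^bsub>G\<^esub>))"
    using hom by (auto simp: hom_def unitary_group_def unitary_def)
  \<comment> \<open>The operator at the unit is idempotent and surjective.\<close>
  have "\<pi> \<one>\<^bsub>G\<^esub> = 1"
  proof (rule bop_eqI)
    fix x
    obtain z where z: "x = bop_apply (\<pi> \<one>\<^bsub>G\<^esub>) z"
      using surj by blast
    have "bop_apply (\<pi> \<one>\<^bsub>G\<^esub> * \<pi> \<one>\<^bsub>G\<^esub>) z = bop_apply (\<pi> \<one>\<^bsub>G\<^esub>) z"
      using mult [of "\<one>\<^bsub>G\<^esub>" "\<one>\<^bsub>G\<^esub>"] by simp
    then show "bop_apply (\<pi> \<one>\<^bsub>G\<^esub>) x = bop_apply 1 x"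
      by (simp add: z)
  qed
  then show ?thesis
    using mult [OF g inv_closed [OF g]] g by simp
qed

lemma Gamma_map_compose:
  assumes \<Phi>: "Gamma_map G \<pi> UNIV \<rho> UNIV \<Phi>" and \<phi>: "Gamma_map G \<rho> UNIV \<sigma> UNIV \<phi>"
  shows "Gamma_map G \<pi> S \<sigma> (range \<phi>) (\<lambda>x. \<phi> (\<Phi> x))"
  using assms unfolding Gamma_map_def by auto

lemma (in tensor_product) Gamma_map_amplification:
  fixes \<pi> :: "'g \<Rightarrow> 'a bop" and \<rho> :: "'g \<Rightarrow> 'b bop"
  assumes "group G" and "unitary_rep G \<rho>"
  shows "Gamma_map G \<pi> UNIV (rep_tensor t \<pi> \<rho>) UNIV (\<lambda>x. op_tensor t x 1)"
proof -
  have "op_tensor t (conj_action G \<pi> g x) 1 =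
      conj_action G (rep_tensor t \<pi> \<rho>) g (op_tensor t x 1)" if "g \<in> carrier G" for g x
  proof (rule bop_eq_on_tensors)
    fix v w
    have "bop_apply (\<rho> g) (bop_apply (\<rho> (inv\<^bsub>G\<^esub> g)) w) = w"
      using arg_cong [OF unitary_rep_mult_inv [OF assms that], of "\<lambda>T. bop_apply T w"] by simp
    then show "bop_apply (op_tensor t (conj_action G \<pi> g x) 1) (t v w) =
        bop_apply (conj_action G (rep_tensor t \<pi> \<rho>) g (op_tensor t x 1)) (t v w)"
      by (simp add: conj_action_def rep_tensor_def)
  qed
  moreover have "op_tensor t (x + y) 1 = op_tensor t x 1 + op_tensor t y 1" for x y
    by (rule bop_eq_on_tensors) (simp add: t_add_left)
  moreover have "op_tensor t (c *\<^sub>C x) 1 = c *\<^sub>C op_tensor t x 1" for c x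
    by (rule bop_eq_on_tensors) (simp add: t_scaleC_left)
  moreover have "op_tensor t 1 1 = 1"
    by (rule bop_eq_on_tensors) simp
  ultimately show ?thesis
    by (simp add: Gamma_map_def positive_matrix_op_tensor_one)
qed

lemma (in tensor_product) Gamma_map_into_FH_boundary:
  fixes \<pi> :: "'g \<Rightarrow> 'a bop" and \<rho> :: "'g \<Rightarrow> 'b bop"
  assumes "group G" and "unitary_rep G \<rho>" and "FH_boundary G (rep_tensor t \<pi> \<rho>) B"
  shows "\<exists>\<Psi>. Gamma_map G \<pi> S (rep_tensor t \<pi> \<rho>) B \<Psi>"
proof -
  obtain \<phi> where "Gamma_map G (rep_tensor t \<pi> \<rho>) UNIV (rep_tensor t \<pi> \<rho>) UNIV \<phi>" "B = range \<phi>"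
    using assms(3) by (auto simp: FH_boundary_def minimal_Gamma_endo_def Gamma_endos_def)
  then show ?thesis
    using Gamma_map_compose [OF Gamma_map_amplification [OF assms(1,2)]] by blast
qed

theorem proposition3p24:
  fixes G :: "('g, 'm) monoid_scheme"
    and \<pi>\<^sub>1 :: "'g \<Rightarrow> 'a::chilbert_space bop"
    and \<pi>\<^sub>2 :: "'g \<Rightarrow> 'b::chilbert_space bop"
    and t :: "'a \<Rightarrow> 'b \<Rightarrow> 'c::chilbert_space"
  assumes "group G"
    and "unitary_rep G \<pi>\<^sub>1" and "unitary_rep G \<pi>\<^sub>2"
    and "hilbert_tensor t"
    and "FH_boundary G \<pi>\<^sub>1 B\<^sub>1" and "FH_boundary G \<pi>\<^sub>2 B\<^sub>2"
    and "FH_boundary G (rep_tensor t \<pi>\<^sub>1 \<pi>\<^sub>2) B"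
  shows "(\<exists>\<Psi>. Gamma_map G \<pi>\<^sub>1 B\<^sub>1 (rep_tensor t \<pi>\<^sub>1 \<pi>\<^sub>2) B \<Psi>) \<and>
    (\<exists>\<Psi>. Gamma_map G \<pi>\<^sub>2 B\<^sub>2 (rep_tensor t \<pi>\<^sub>1 \<pi>\<^sub>2) B \<Psi>)"
proof -
  interpret tensor_product t
    by unfold_locales fact
  interpret flip: tensor_product "\<lambda>y x. t x y"
    by unfold_locales (rule hilbert_tensor_flip)
  have "rep_tensor (\<lambda>y x. t x y) \<pi>\<^sub>2 \<pi>\<^sub>1 = rep_tensor t \<pi>\<^sub>1 \<pi>\<^sub>2"
    by (rule ext) (simp add: rep_tensor_def op_tensor_flip)
  then show ?thesis
    using assms Gamma_map_into_FH_boundary flip.Gamma_map_into_FH_boundary by metis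
qed

end
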